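(* For every integer $n\ge0$, $$2^n\mu_n(a,q/a,0,0;q) = \sum_{k=0}^{n} \left( \binom{n}{\frac{n-k}2}-\binom{n}{\frac{n-k}2-1}\right) (q/a)^k \sum_{i=0}^k a^{2i} q^{i(k-i-1)}.$$
   Context: Let $a,b,c,d,q$ be indeterminates (generic parameters). The monic Askey-Wilson polynomials $P_n(x)=P_n(x;a,b,c,d;q)$ are defined by $P_{-1}=0$, $P_0=1$, $P_{n+1}=(x-b_n)P_n-\lambda_nP_{n-1}$, with $b_n=\frac12(a+a^{-1}-(A_n+C_n))$, $\lambda_n=\frac14A_{n-1}C_n$, where $$A_n=\frac{(1-abq^n)(1-acq^n)(1-adq^n)(1-abcdq^{n-1})}{a(1-abcdq^{2n-1})(1-abcdq^{2n})},\quad C_n=\frac{a(1-q^n)(1-bcq^{n-1})(1-bdq^{n-1})(1-cdq^{n-1})}{(1-abcdq^{2n-2})(1-abcdq^{2n-1})}$$ (for $n=0$ the common factor $1-abcdq^{-1}$ in $A_0$ is cancelled, and $C_0=0$). The moment $\mu_n(a,b,c,d;q)=L(x^n)$, where $L$ is the unique linear functional on polynomials in $x$ with $L(1)=1$ and $L(P_n)=0$ for all $n\ge1$ (so that $L(P_mP_n)=0$ for $m\neq n$). It is a rational function of $a,b,c,d,q$, symmetric in $a,b,c,d$; here it is specialized at $b=q/a$, $c=d=0$. Convention: $\binom{n}{r}=0$ unless $r$ is an integer with $0\le r\le n$ (so only $k\equiv n\bmod 2$ contribute). *)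

theory Defs
  imports Complex_Main "HOL-Computational_Algebra.Computational_Algebra"
begin

text \<open>
  The parameters are elements of an arbitrary field of characteristic 0. The case of
  indeterminates is the one where the field is a field of rational functions, such as
  \<^typ>\<open>rat poly poly fract\<close>; the following instance makes it available.
\<close>

instance fract :: ("{idom,ring_char_0}") field_char_0
proof
  have eq: "of_nat n = Fract (of_nat n :: 'a) 1" for n
    by (induction n) (auto simp: Zero_fract_def One_fract_def)
  show "inj (of_nat :: nat \<Rightarrow> 'a fract)"
    by (rule injI) (simp add: eq eq_fract)
qed


text \<open>
  At \<open>n = 0\<close> the factor \<open>1 - abcd/q\<close>, common to the numerator and the denominator, is
  cancelled; this also avoids the truncated exponents \<open>n - 1\<close> and \<open>2 * n - 1\<close>.
\<close>

definition aw_A :: "'a::field \<Rightarrow> 'a \<Rightarrow> 'a \<Rightarrow> 'a \<Rightarrow> 'a \<Rightarrow> nat \<Rightarrow> 'a" where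
  "aw_A a b c d q n =
     (if n = 0
      then (1 - a*b) * (1 - a*c) * (1 - a*d) / (a * (1 - a*b*c*d))
      else (1 - a*b*q^n) * (1 - a*c*q^n) * (1 - a*d*q^n) * (1 - a*b*c*d*q^(n-1)) /
           (a * (1 - a*b*c*d*q^(2*n-1)) * (1 - a*b*c*d*q^(2*n))))"

definition aw_C :: "'a::field \<Rightarrow> 'a \<Rightarrow> 'a \<Rightarrow> 'a \<Rightarrow> 'a \<Rightarrow> nat \<Rightarrow> 'a" where
  "aw_C a b c d q n =
     (if n = 0
      then 0
      else a * (1 - q^n) * (1 - b*c*q^(n-1)) * (1 - b*d*q^(n-1)) * (1 - c*d*q^(n-1)) /
           ((1 - a*b*c*d*q^(2*n-2)) * (1 - a*b*c*d*q^(2*n-1))))"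

definition aw_b :: "'a::field \<Rightarrow> 'a \<Rightarrow> 'a \<Rightarrow> 'a \<Rightarrow> 'a \<Rightarrow> nat \<Rightarrow> 'a" where
  "aw_b a b c d q n = 1/2 * (a + inverse a - (aw_A a b c d q n + aw_C a b c d q n))"

text \<open>Only used for \<open>n \<ge> 1\<close>, since \<open>\<lambda>\<^sub>0\<close> is multiplied by \<open>P\<^sub>-\<^sub>1 = 0\<close>.\<close>

definition aw_lambda :: "'a::field \<Rightarrow> 'a \<Rightarrow> 'a \<Rightarrow> 'a \<Rightarrow> 'a \<Rightarrow> nat \<Rightarrow> 'a" where
  "aw_lambda a b c d q n = 1/4 * aw_A a b c d q (n-1) * aw_C a b c d q n"

fun aw_poly :: "'a::field \<Rightarrow> 'a \<Rightarrow> 'a \<Rightarrow> 'a \<Rightarrow> 'a \<Rightarrow> nat \<Rightarrow> 'a poly" where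
  "aw_poly a b c d q 0 = 1"
| "aw_poly a b c d q (Suc 0) = [:- aw_b a b c d q 0, 1:]"
| "aw_poly a b c d q (Suc (Suc n)) =
     [:- aw_b a b c d q (Suc n), 1:] * aw_poly a b c d q (Suc n)
     - smult (aw_lambda a b c d q (Suc n)) (aw_poly a b c d q n)"

definition is_aw_functional ::
    "'a::field \<Rightarrow> 'a \<Rightarrow> 'a \<Rightarrow> 'a \<Rightarrow> 'a \<Rightarrow> ('a poly \<Rightarrow> 'a) \<Rightarrow> bool" where
  "is_aw_functional a b c d q L \<longleftrightarrow>
     Vector_Spaces.linear smult (*) L \<and> L 1 = 1 \<and> (\<forall>n\<ge>1. L (aw_poly a b c d q n) = 0)"

definition aw_functional :: "'a::field \<Rightarrow> 'a \<Rightarrow> 'a \<Rightarrow> 'a \<Rightarrow> 'a \<Rightarrow> 'a poly \<Rightarrow> 'a" where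
  "aw_functional a b c d q = (THE L. is_aw_functional a b c d q L)"

text \<open>
  The moment, evaluated at given elements of the field. This is the value of the rational
  function \<open>\<mu>\<^sub>n\<close> wherever none of the denominators in the recurrence coefficients vanish. For
  \<open>c = d = 0\<close> these denominators are just \<open>a\<close> and \<open>1\<close>, so that \<open>a \<noteq> 0\<close> suffices.
\<close>

definition aw_moment :: "'a::field \<Rightarrow> 'a \<Rightarrow> 'a \<Rightarrow> 'a \<Rightarrow> 'a \<Rightarrow> nat \<Rightarrow> 'a" where
  "aw_moment a b c d q n = aw_functional a b c d q (monom 1 n)"

text \<open>Binomial coefficient with a rational lower entry, zero unless that is an integer in \<open>[0, n]\<close>.\<close>

definition binom_ext :: "nat \<Rightarrow> rat \<Rightarrow> nat" where
  "binom_ext n r = (if r \<in> \<int> \<and> 0 \<le> r \<and> r \<le> of_nat n then n choose nat \<lfloor>r\<rfloor> else 0)"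


text \<open>Existence and uniqueness of the functional, i.e. \<^const>\<open>aw_functional\<close> is well defined.\<close>

lemma aw_poly_monic:
  "degree (aw_poly a b c d q n) = n \<and> coeff (aw_poly a b c d q n) n = 1"
proof (induction n rule: less_induct)
  case (less n)
  consider "n = 0" | "n = Suc 0" | m where "n = Suc (Suc m)"
    by (metis not0_implies_Suc)
  then show ?case
  proof cases
    case 3
    let ?p = "aw_poly a b c d q (Suc m)" and ?r = "aw_poly a b c d q m"
    have 1: "degree ?p = Suc m" "coeff ?p (Suc m) = 1" "degree ?r = m"
      using less 3 by auto
    have eq: "aw_poly a b c d q n =
        pCons 0 ?p - (smult (aw_b a b c d q (Suc m)) ?p + smult (aw_lambda a b c d q (Suc m)) ?r)"
      by (simp add: 3 mult_pCons_left)
    have c: "coeff (aw_poly a b c d q n) n = 1"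
      using 1 by (simp add: eq 3 coeff_eq_0)
    have "degree (aw_poly a b c d q n) \<le> n"
      by (rule degree_le) (use 1 in \<open>auto simp: eq 3 coeff_pCons coeff_eq_0 split: nat.splits\<close>)
    then show ?thesis
      using c by (simp add: le_antisym le_degree)
  qed auto
qed

lemma linear_functional_poly_sum:
  fixes L :: "'a::field poly \<Rightarrow> 'a"
  assumes "Vector_Spaces.linear smult (*) L" "degree p \<le> n"
  shows "L p = (\<Sum>i\<le>n. coeff p i * L (monom 1 i))"
proof -
  interpret L: Vector_Spaces.linear smult "(*)" L by fact
  have "p = (\<Sum>i\<le>n. monom (coeff p i) i)"
    using assms(2) by (rule poly_as_sum_of_monoms'[symmetric])
  also have "\<dots> = (\<Sum>i\<le>n. smult (coeff p i) (monom 1 i))"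
    by (simp add: smult_monom)
  finally have "L p = L (\<Sum>i\<le>n. smult (coeff p i) (monom 1 i))"
    by (rule arg_cong)
  then show ?thesis
    by (simp add: L.sum L.scale)
qed

lemma ex1_aw_functional: "\<exists>!L. is_aw_functional a b c d q L"
proof -
  let ?P = "aw_poly a b c d q"
  define m where "m = wfrec less_than
    (\<lambda>f n. if n = 0 then 1 else - (\<Sum>i<n. coeff (?P n) i * f i))"
  have m: "m n = (if n = 0 then 1 else - (\<Sum>i<n. coeff (?P n) i * m i))" for n
    unfolding m_def by (subst wfrec) (auto simp: cut_def intro!: sum.cong)
  define L where "L = (\<lambda>p. \<Sum>i\<le>degree p. coeff p i * m i)"
  have L: "L p = (\<Sum>i\<le>n. coeff p i * m i)" if "degree p \<le> n" for p n
    unfolding L_def using that by (intro sum.mono_neutral_left) (auto simp: coeff_eq_0)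
  have "Vector_Spaces.linear smult (*) L"
  proof (unfold_locales, goal_cases)
    case (9 p r)
    show ?case
      using L[of "p + r" "max (degree p) (degree r)"] L[of p "max (degree p) (degree r)"]
        L[of r "max (degree p) (degree r)"]
      by (simp add: degree_add_le_max sum.distrib algebra_simps)
  next
    case (10 x p)
    show ?case
      using L[of "smult x p" "degree p"] L[of p "degree p"]
      by (simp add: sum_distrib_left mult.assoc degree_smult_le)
  qed (auto simp: smult_add_right smult_add_left algebra_simps)
  moreover have "L 1 = 1"
    by (simp add: L_def m[of 0])
  moreover have "L (?P n) = 0" if "n \<ge> 1" for n
  proof -
    have "L (?P n) = (\<Sum>i<n. coeff (?P n) i * m i) + m n"
      using aw_poly_monic[of a b c d q n]
      by (simp add: L[of _ n] flip: lessThan_Suc_atMost)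
    then show ?thesis
      using m[of n] that by simp
  qed
  ultimately have "is_aw_functional a b c d q L"
    by (simp add: is_aw_functional_def)
  moreover have "M = N" if M: "is_aw_functional a b c d q M" and N: "is_aw_functional a b c d q N" for M N
  proof -
    have rec: "K (monom 1 n) = (if n = 0 then 1 else - (\<Sum>i<n. coeff (?P n) i * K (monom 1 i)))"
      if K: "is_aw_functional a b c d q K" for K n
    proof (cases "n = 0")
      case False
      have "K (?P n) = (\<Sum>i\<le>n. coeff (?P n) i * K (monom 1 i))"
        using K aw_poly_monic[of a b c d q n]
        by (intro linear_functional_poly_sum) (auto simp: is_aw_functional_def)
      moreover have "K (?P n) = 0"
        using K False by (auto simp: is_aw_functional_def)
      ultimately show ?thesis
        using False aw_poly_monic[of a b c d q n]
        by (simp add: add_eq_0_iff flip: lessThan_Suc_atMost)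
    qed (use K in \<open>simp add: is_aw_functional_def\<close>)
    have eq: "M (monom 1 n) = N (monom 1 n)" for n
    proof (induction n rule: less_induct)
      case (less n)
      then show ?case
        by (subst rec[OF M], subst rec[OF N]) (auto intro!: sum.cong)
    qed
    show ?thesis
      using M N by (intro ext) (simp add: is_aw_functional_def eq
          linear_functional_poly_sum[OF _ order.refl])
  qed
  ultimately show ?thesis by blast
qed

end

theory Submission
  imports Defs
begin

text \<open>
  Put \<open>b = q/a\<close> and let \<open>U\<^sub>k\<close> be the Chebyshev polynomials of the second kind. Since
  \<open>2\<^sup>n x\<^sup>n\<close> expands in the \<open>U\<^sub>k\<close> with ballot numbers as coefficients, it suffices to
  show \<open>L(U\<^sub>k) = \<Sum>i+j=k. a\<^sup>i b\<^sup>j q\<^bsup>ij\<^esup>\<close>. More generally, for \<open>k \<ge> n\<close>,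
  \<open>2\<^sup>n L(U\<^sub>k P\<^sub>n)\<close> is the sum over \<open>i + j = k - n\<close> of
  \<open>a\<^sup>i b\<^sup>j q\<^bsup>ij\<^esup> (q\<^bsup>i+1\<^esup>;q)\<^sub>n (q\<^bsup>j+1\<^esup>;q)\<^sub>n\<close>, and it vanishes for \<open>k < n\<close>. Both sides
  satisfy the same recurrence in \<open>k\<close>, given by the recurrences of \<open>U\<^sub>k\<close> and \<open>P\<^sub>n\<close>, and
  they agree for \<open>k = 0\<close> by the definition of \<open>L\<close>.
\<close>

section \<open>Binomials with rational lower index and ballot numbers\<close>

lemma binom_ext_Suc: "binom_ext (Suc n) r = binom_ext n r + binom_ext n (r - 1)"
proof (cases "r \<in> \<int>")
  case True
  then obtain z where z: "r = of_int z"
    by (auto elim: Ints_cases)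
  have ext: "binom_ext m (of_int y) = (if 0 \<le> y then m choose nat y else 0)" for m y
  proof -
    have "(of_int y :: rat) \<le> of_nat m \<longleftrightarrow> y \<le> int m"
      by (metis of_int_le_iff of_int_of_nat_eq)
    then show ?thesis
      by (cases "y \<le> int m") (simp_all add: binom_ext_def binomial_eq_0)
  qed
  have r1: "r - 1 = of_int (z - 1)"
    by (simp add: z)
  show ?thesis
  proof (cases "z \<le> 0")
    case False
    then obtain k where "z = int (Suc k)"
      by (metis not_le pos_int_cases gr0_implies_Suc)
    then show ?thesis
      unfolding r1 unfolding z ext by (simp add: nat_add_distrib)
  qed (unfold r1, unfold z ext, auto)
next
  case False
  then have "r - 1 \<notin> \<int>"
    by (metis Ints_1 Ints_add diff_add_cancel)
  with False show ?thesis
    by (simp add: binom_ext_def)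
qed

lemma binom_ext_symmetric: "binom_ext n (of_nat n - r) = binom_ext n r"
proof (cases "r \<in> \<int> \<and> 0 \<le> r \<and> r \<le> of_nat n")
  case True
  then obtain z where z: "r = of_int z"
    by (auto elim: Ints_cases)
  with True have "0 \<le> z"
    by simp
  then obtain k where "z = int k"
    by (rule nonneg_int_cases)
  with z True have k: "r = of_nat k" "k \<le> n"
    by auto
  then have "of_nat n - r = of_nat (n - k)"
    by simp
  moreover have "binom_ext n (of_nat j) = n choose j" for j
    by (cases "j \<le> n") (simp_all add: binom_ext_def binomial_eq_0)
  ultimately show ?thesis
    using binomial_symmetric[OF k(2)] by (simp only: k(1))
next
  case False
  moreover have "of_nat n - r \<in> \<int> \<longleftrightarrow> r \<in> \<int>"
    using Ints_diff[OF Ints_of_nat, of r n] Ints_diff[OF Ints_of_nat, of "of_nat n - r" n] by auto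
  ultimately show ?thesis
    by (auto simp: binom_ext_def)
qed

text \<open>Ballot numbers: nonnegative paths with n steps +1 or -1 from height 0 to height k. For n
  - k odd the lower indices are half-integers and both terms vanish.\<close>

definition ballot :: "nat \<Rightarrow> nat \<Rightarrow> 'a::ring_1" where
  "ballot n k = of_nat (binom_ext n ((of_nat n - of_nat k) / 2))
     - of_nat (binom_ext n ((of_nat n - of_nat k) / 2 - 1))"

lemma ballot_0_0: "ballot 0 0 = 1"
  by (simp add: ballot_def binom_ext_def)

lemma ballot_eq_0: "n < k \<Longrightarrow> ballot n k = 0"
  by (simp add: ballot_def binom_ext_def)

lemma ballot_Suc_Suc: "ballot (Suc n) (Suc k) = ballot n k + ballot n (Suc (Suc k))"
proof -
  have r: "(of_nat (Suc n) - of_nat (Suc k)) / 2 = (of_nat n - of_nat k) / (2::rat)"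
    "(of_nat n - of_nat (Suc (Suc k))) / 2 = (of_nat n - of_nat k) / 2 - (1::rat)"
    by (simp_all add: field_simps)
  show ?thesis
    unfolding ballot_def r binom_ext_Suc by simp
qed

text \<open>A nonnegative path ending at height 0 must come from height 1. Pascal's rule produces
  the lower index n - s where \<open>ballot n 1\<close> has s = (n - 1)/2; the symmetry of the
  binomial identifies the two.\<close>

lemma ballot_Suc_0: "ballot (Suc n) 0 = ballot n 1"
proof -
  define s :: rat where "s = (of_nat n - of_nat 1) / 2"
  have r: "(of_nat (Suc n) - of_nat 0) / 2 = of_nat n - s" "of_nat n - s - 1 = s"
    by (simp_all add: s_def field_simps)
  have "ballot (Suc n) 0 = of_nat (binom_ext n (of_nat n - s) + binom_ext n s)
      - of_nat (binom_ext n s + binom_ext n (s - 1))"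
    by (simp only: ballot_def r binom_ext_Suc)
  then show ?thesis
    by (simp add: ballot_def binom_ext_symmetric s_def)
qed

section \<open>Chebyshev expansion of powers of 2x\<close>

fun chebyshev_U :: "nat \<Rightarrow> 'a::comm_ring_1 poly" where
  "chebyshev_U 0 = 1"
| "chebyshev_U (Suc 0) = [:0, 2:]"
| "chebyshev_U (Suc (Suc k)) = [:0, 2:] * chebyshev_U (Suc k) - chebyshev_U k"

text \<open>Induction by multiplying with 2x: as 2x U_k = U_(k+1) + U_(k-1), the coefficients obey
  the ballot recurrences, and \<open>ballot_Suc_0\<close> reflects U_(-1) = 0.\<close>

lemma monom_eq_sum_chebyshev_U:
  "monom (2 ^ n) n = (\<Sum>k\<le>n. smult (ballot n k) (chebyshev_U k) :: 'a::comm_ring_1 poly)"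
proof (induction n)
  case 0
  show ?case
    by (simp add: ballot_0_0)
next
  case (Suc n)
  let ?U = "chebyshev_U :: nat \<Rightarrow> 'a poly"
  have "(\<Sum>k\<le>Suc n. smult (ballot (Suc n) k) (?U k)) =
      smult (ballot n 1) (?U 0) + (\<Sum>k\<le>n. smult (ballot n (Suc (Suc k))) (?U (Suc k)))
      + (\<Sum>k\<le>n. smult (ballot n k) (?U (Suc k)))"
    by (subst sum.atMost_Suc_shift)
      (simp add: ballot_Suc_0 ballot_Suc_Suc smult_add_left sum.distrib)
  also have "smult (ballot n 1) (?U 0) + (\<Sum>k\<le>n. smult (ballot n (Suc (Suc k))) (?U (Suc k)))
      = (\<Sum>k\<le>Suc n. smult (ballot n (Suc k)) (?U k))"
    by (subst sum.atMost_Suc_shift) simp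
  \<comment> \<open>The dropped top coefficients are \<open>ballot n (n + 1)\<close> and
    \<open>ballot n (n + 2)\<close>; what is left is the lowering part of 2x U_k.\<close>
  also have "\<dots> = (\<Sum>k<n. smult (ballot n (Suc k)) (?U k))"
    by (rule sum.mono_neutral_right) (auto simp: ballot_eq_0)
  also have "\<dots> + (\<Sum>k\<le>n. smult (ballot n k) (?U (Suc k))) =
      [:0, 2:] * (\<Sum>k\<le>n. smult (ballot n k) (?U k))"
  proof (cases n)
    case (Suc m)
    have U: "[:0, 2:] * ?U (Suc k) = ?U (Suc (Suc k)) + ?U k" for k
      by simp
    show ?thesis
      unfolding Suc sum.atMost_Suc_shift[of _ m] distrib_left sum_distrib_left
        mult_smult_right U smult_add_right sum.distrib lessThan_Suc_atMost
      by (simp add: ac_simps)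
  qed simp
  also have "\<dots> = monom (2 ^ Suc n) (Suc n)"
    by (simp add: mult_monom flip: Suc.IH) (simp add: monom_Suc smult_monom)
  finally show ?case ..
qed

section \<open>q-Pochhammer symbols (q^i;q)_n and the coefficient recurrence\<close>

definition qprod :: "'a::comm_ring_1 \<Rightarrow> nat \<Rightarrow> nat \<Rightarrow> 'a" where
  "qprod q i n = (\<Prod>m<n. 1 - q ^ (i + m))"

lemma qprod_0: "qprod q i 0 = 1"
  and qprod_Suc: "qprod q i (Suc n) = qprod q i n * (1 - q ^ (i + n))"
  by (simp_all add: qprod_def)

lemma qprod_Suc_left: "qprod q i (Suc n) = (1 - q ^ i) * qprod q (Suc i) n"
  unfolding qprod_def by (subst prod.lessThan_Suc_shift) (simp add: o_def)

definition aw_coeff :: "'a::comm_ring_1 \<Rightarrow> nat \<Rightarrow> nat \<Rightarrow> nat \<Rightarrow> 'a" where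
  "aw_coeff q n i j = q ^ (i * j) * qprod q (Suc i) n * qprod q (Suc j) n"

text \<open>Multiplication by a (\<open>shift2\<close>: by b) on the level of coefficients.\<close>

definition shift1 :: "(nat \<Rightarrow> nat \<Rightarrow> 'a::zero) \<Rightarrow> nat \<Rightarrow> nat \<Rightarrow> 'a" where
  "shift1 f i j = (case i of 0 \<Rightarrow> 0 | Suc i' \<Rightarrow> f i' j)"

definition shift2 :: "(nat \<Rightarrow> nat \<Rightarrow> 'a::zero) \<Rightarrow> nat \<Rightarrow> nat \<Rightarrow> 'a" where
  "shift2 f i j = (case j of 0 \<Rightarrow> 0 | Suc j' \<Rightarrow> f i j')"

text \<open>
  The polynomial identity, with \<open>x = q\<^sup>i\<close>, \<open>y = q\<^sup>j\<close>, \<open>t = q\<^sup>n\<close>, to which the recurrence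
  \<open>aw_coeff_rec\<close> reduces after the common factors are cancelled.
\<close>

lemma aw_coeff_rec_identity:
  fixes x y t :: "'a::idom"
  shows "x * y * ((1 - x*t) * (1 - y*t)) + (1 - x) * (1 - y) =
    (1 - x) * (1 - x*t) * ((1 - y) * (1 - y*t))
    + t * (x * (1 - x) * (1 - y*t) + y * (1 - y) * (1 - x*t)) + (1 - t)\<^sup>2 * (x * y)"
  by algebra

text \<open>The weights of a^i b^j in the recurrence for 2^n L(U_k P_n), multiplied by q = ab: terms
  two degrees lower become double shifts, so all degrees agree. It fails at n = i = j = 0 (left side
  q, right side 0), where the initial value L(1) = 1 enters instead.\<close>

lemma aw_coeff_rec:
  fixes q :: "'a::field"
  assumes "q \<noteq> 0" "n \<noteq> 0 \<or> i \<noteq> 0 \<or> j \<noteq> 0"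
  shows "q * aw_coeff q n i j + shift1 (shift2 (aw_coeff q n)) i j =
     shift1 (shift2 (aw_coeff q (Suc n))) i j
     + q * (q ^ n * (shift1 (aw_coeff q n) i j + shift2 (aw_coeff q n) i j))
     + q * ((1 - q ^ n)\<^sup>2 * aw_coeff q (n - 1) i j)"
proof (cases n)
  case 0
  from assms 0 consider i' where "i = Suc i'" "j = 0" | j' where "i = 0" "j = Suc j'"
    | i' j' where "i = Suc i'" "j = Suc j'"
    by (metis not0_implies_Suc)
  then show ?thesis
    unfolding 0 aw_coeff_def shift1_def shift2_def
    by cases (simp_all add: qprod_0 qprod_Suc algebra_simps power_add)
next
  case (Suc p)
  define c where "c = q * q ^ (i * j)"
  define u where "u = qprod q (Suc i) p"
  define v where "v = qprod q (Suc j) p"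
  \<comment> \<open>The factor q^(i+j) removes the case split of the shifts: (i-1)(j-1) + i + j = ij
    + 1, and at i = 0 or j = 0 both sides vanish by the factor 1 - q^0. That factor requires a
    nonempty product, hence the separate case n = 0.\<close>
  have s0: "q ^ (i + j) * shift1 (shift2 (aw_coeff q (Suc k))) i j
      = c * qprod q i (Suc k) * qprod q j (Suc k)" for k
    by (cases i; cases j)
      (simp_all add: c_def shift1_def shift2_def aw_coeff_def qprod_Suc_left[of q 0] power_add mult_ac)
  have s1: "q ^ j * shift1 (aw_coeff q (Suc k)) i j
      = q ^ (i * j) * qprod q i (Suc k) * qprod q (Suc j) (Suc k)" for k
    by (cases i) (simp_all add: shift1_def aw_coeff_def qprod_Suc_left[of q 0] power_add mult_ac)
  have s2: "q ^ i * shift2 (aw_coeff q (Suc k)) i j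
      = q ^ (i * j) * qprod q (Suc i) (Suc k) * qprod q j (Suc k)" for k
    by (cases j) (simp_all add: shift2_def aw_coeff_def qprod_Suc_left[of q 0] power_add mult_ac)
  \<comment> \<open>Every product that occurs is \<open>u\<close> or \<open>v\<close>, of length n -
    1, times at most two further factors.\<close>
  have u: "qprod q i n = (1 - q ^ i) * u" "qprod q (Suc i) n = u * (1 - q ^ i * q ^ n)"
    "qprod q i (Suc n) = (1 - q ^ i) * u * (1 - q ^ i * q ^ n)"
    by (simp_all only: u_def Suc qprod_Suc_left[of q i] qprod_Suc[of q "Suc i"])
      (simp_all add: power_add mult_ac)
  have v: "qprod q j n = (1 - q ^ j) * v" "qprod q (Suc j) n = v * (1 - q ^ j * q ^ n)"
    "qprod q j (Suc n) = (1 - q ^ j) * v * (1 - q ^ j * q ^ n)"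
    by (simp_all only: v_def Suc qprod_Suc_left[of q j] qprod_Suc[of q "Suc j"])
      (simp_all add: power_add mult_ac)
  have "q ^ (i + j) * (q * aw_coeff q n i j + shift1 (shift2 (aw_coeff q n)) i j) =
      q ^ (i + j) * (q * aw_coeff q n i j) + c * qprod q i n * qprod q j n"
    by (simp only: distrib_left s0 Suc)
  also have "\<dots> = c * u * v * (q ^ i * q ^ j * ((1 - q ^ i * q ^ n) * (1 - q ^ j * q ^ n))
      + (1 - q ^ i) * (1 - q ^ j))"
    unfolding aw_coeff_def u v by (simp only: c_def power_add distrib_left mult_ac)
  also have "\<dots> = c * u * v * ((1 - q ^ i) * (1 - q ^ i * q ^ n) * ((1 - q ^ j) * (1 - q ^ j * q ^ n))
      + q ^ n * (q ^ i * (1 - q ^ i) * (1 - q ^ j * q ^ n) + q ^ j * (1 - q ^ j) * (1 - q ^ i * q ^ n))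
      + (1 - q ^ n)\<^sup>2 * (q ^ i * q ^ j))"
    unfolding aw_coeff_rec_identity ..
  also have "\<dots> = c * qprod q i (Suc n) * qprod q j (Suc n)
      + q * (q ^ n * (q ^ i * (q ^ (i * j) * qprod q i n * qprod q (Suc j) n)
         + q ^ j * (q ^ (i * j) * qprod q (Suc i) n * qprod q j n)))
      + q ^ (i + j) * (q * ((1 - q ^ n)\<^sup>2 * (q ^ (i * j) * u * v)))"
    unfolding u v by (simp only: c_def power_add distrib_left mult_ac)
  also have "\<dots> = q ^ (i + j) * (shift1 (shift2 (aw_coeff q (Suc n))) i j
     + q * (q ^ n * (shift1 (aw_coeff q n) i j + shift2 (aw_coeff q n) i j))
     + q * ((1 - q ^ n)\<^sup>2 * aw_coeff q (n - 1) i j))"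
    unfolding s0[symmetric] unfolding Suc s1[symmetric] s2[symmetric]
    by (simp only: u_def v_def aw_coeff_def diff_Suc_1 power_add distrib_left mult_ac)
  finally show ?thesis
    using assms(1) by (simp only: mult_cancel_left) simp
qed

section \<open>Homogeneous sums in a and b\<close>

definition hsum :: "'a::comm_ring_1 \<Rightarrow> 'a \<Rightarrow> (nat \<Rightarrow> nat \<Rightarrow> 'a) \<Rightarrow> nat \<Rightarrow> 'a" where
  "hsum a b f m = (\<Sum>i\<le>m. a ^ i * b ^ (m - i) * f i (m - i))"

lemma hsum_add: "hsum a b (\<lambda>i j. f i j + g i j) m = hsum a b f m + hsum a b g m"
  by (simp add: hsum_def algebra_simps sum.distrib)

lemma hsum_cmult: "hsum a b (\<lambda>i j. c * f i j) m = c * hsum a b f m"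
  by (simp add: hsum_def sum_distrib_left mult_ac)

lemma hsum_shift1: "hsum a b (shift1 f) m = (if m = 0 then 0 else a * hsum a b f (m - 1))"
proof (cases m)
  case (Suc n)
  show ?thesis
    unfolding Suc hsum_def
    by (subst sum.atMost_Suc_shift) (simp add: shift1_def sum_distrib_left mult_ac)
qed (simp add: hsum_def shift1_def)

lemma hsum_shift2: "hsum a b (shift2 f) m = (if m = 0 then 0 else b * hsum a b f (m - 1))"
proof (cases m)
  case (Suc n)
  show ?thesis
    unfolding Suc hsum_def
    by (simp add: shift2_def sum_distrib_left mult_ac Suc_diff_le)
qed (simp add: hsum_def shift2_def)

text \<open>Sum \<open>aw_coeff_rec\<close> over i + j = m; shifts turn into factors a and b, and
  the common factor q = ab cancels. The conditionals set sums of negative degree to 0, where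
  truncated subtraction would give degree 0.\<close>

lemma hsum_aw_coeff_rec:
  fixes a b :: "'a::field"
  assumes q: "q = a * b" "q \<noteq> 0" and nm: "n \<noteq> 0 \<or> m \<noteq> 0"
  defines "S \<equiv> \<lambda>n. hsum a b (aw_coeff q n)"
  shows "S n m + (if m < 2 then 0 else S n (m - 2)) =
    (if m < 2 then 0 else S (Suc n) (m - 2))
    + q ^ n * (a + b) * (if m = 0 then 0 else S n (m - 1)) + (1 - q ^ n)\<^sup>2 * S (n - 1) m"
proof -
  have shift12: "hsum a b (shift1 (shift2 f)) m = q * (if m < 2 then 0 else hsum a b f (m - 2))" for f
    by (auto simp: hsum_shift1 hsum_shift2 q numeral_2_eq_2)
  have "hsum a b (\<lambda>i j. q * aw_coeff q n i j + shift1 (shift2 (aw_coeff q n)) i j) m =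
    hsum a b (\<lambda>i j. shift1 (shift2 (aw_coeff q (Suc n))) i j
     + q * (q ^ n * (shift1 (aw_coeff q n) i j + shift2 (aw_coeff q n) i j))
     + q * ((1 - q ^ n)\<^sup>2 * aw_coeff q (n - 1) i j)) m"
    unfolding hsum_def using nm q(2) by (intro sum.cong[OF refl], subst aw_coeff_rec) auto
  then have "q * (S n m + (if m < 2 then 0 else S n (m - 2))) =
    q * (if m < 2 then 0 else S (Suc n) (m - 2))
    + q * (q ^ n * ((if m = 0 then 0 else a * S n (m - 1)) + (if m = 0 then 0 else b * S n (m - 1))))
    + q * ((1 - q ^ n)\<^sup>2 * S (n - 1) m)"
    unfolding hsum_add hsum_cmult shift12 unfolding hsum_shift1 hsum_shift2 S_def
    by (simp only: distrib_left)
  also have "\<dots> = q * ((if m < 2 then 0 else S (Suc n) (m - 2))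
    + q ^ n * (a + b) * (if m = 0 then 0 else S n (m - 1)) + (1 - q ^ n)\<^sup>2 * S (n - 1) m)"
    by (cases "m = 0") (simp_all add: distrib_left distrib_right mult_ac del: mult_cancel_left)
  finally show ?thesis
    using q(2) by (simp only: mult_cancel_left) simp
qed

section \<open>Recurrence coefficients at b = q/a, c = d = 0\<close>

lemma aw_A_special:
  "a \<noteq> 0 \<Longrightarrow> aw_A a (q / a) 0 0 q n = (1 - q * q ^ n) / a"
  by (simp add: aw_A_def)

lemma aw_C_special: "aw_C a b 0 0 q n = a * (1 - q ^ n)"
  by (simp add: aw_C_def)

lemma aw_b_special:
  fixes a q :: "'a::field_char_0"
  shows "a \<noteq> 0 \<Longrightarrow> 2 * aw_b a (q / a) 0 0 q n = q ^ n * (a + q / a)"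
  unfolding aw_b_def aw_A_special aw_C_special
  by (simp add: diff_divide_distrib inverse_eq_divide distrib_left right_diff_distrib)

lemma aw_lambda_special:
  fixes a q :: "'a::field_char_0"
  shows "a \<noteq> 0 \<Longrightarrow> 4 * aw_lambda a (q / a) 0 0 q (Suc n) = (1 - q ^ Suc n)\<^sup>2"
  unfolding aw_lambda_def aw_A_special aw_C_special by (simp add: power2_eq_square)

text \<open>Scaling P_n by 2^n gives a recurrence for multiplication by 2x, as for U_k, with
  coefficients 2 b_n and 4 \<lambda>_n. Here u stands for 2^(n-1).\<close>

lemma scaled_recurrence:
  fixes p r :: "'a::comm_ring_1 poly"
  shows "[:0, 2:] * smult (2 * u) p =
    smult (2 * (2 * u)) ([:- \<beta>, 1:] * p - smult l r)
    + smult (2 * \<beta>) (smult (2 * u) p) + smult (4 * l) (smult u r)"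
  by (rule poly_eqI) (simp add: coeff_pCons algebra_simps split: nat.split)

section \<open>Values of the functional on U_k P_n\<close>

lemma is_aw_functional_aw_functional: "is_aw_functional a b c d q (aw_functional a b c d q)"
  unfolding aw_functional_def by (rule theI'[OF ex1_aw_functional])

lemma aw_functional_chebyshev_U_mult:
  fixes a q :: "'a::field_char_0"
  assumes nz: "a \<noteq> 0" "q \<noteq> 0"
  defines "L \<equiv> aw_functional a (q / a) 0 0 q"
  shows "2 ^ n * L (chebyshev_U k * aw_poly a (q / a) 0 0 q n) =
    (if n \<le> k then hsum a (q / a) (aw_coeff q n) (k - n) else 0)"
proof -
  define b where "b = q / a"
  have q: "q = a * b"
    using nz by (simp add: b_def)
  define Q where "Q = (\<lambda>n. smult (2 ^ n) (aw_poly a b 0 0 q n))"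
  define S where "S = (\<lambda>n. hsum a b (aw_coeff q n))"
  define G where "G = (\<lambda>n k. if n \<le> k then S n (k - n) else 0)"
  have L: "is_aw_functional a b 0 0 q L"
    unfolding L_def b_def by (rule is_aw_functional_aw_functional)
  then have L1: "L 1 = 1"
    by (simp add: is_aw_functional_def)
  have LP: "L (aw_poly a b 0 0 q n) = 0" if "n \<ge> 1" for n
    using L that by (simp add: is_aw_functional_def)
  interpret L: Vector_Spaces.linear smult "(*)" L
    using L by (simp add: is_aw_functional_def)
  have aw_b: "2 * aw_b a b 0 0 q n = q ^ n * (a + b)" for n
    unfolding b_def by (rule aw_b_special[OF nz(1)])
  have aw_lambda: "4 * aw_lambda a b 0 0 q (Suc n) = (1 - q ^ Suc n)\<^sup>2" for n
    unfolding b_def by (rule aw_lambda_special[OF nz(1)])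
  \<comment> \<open>At n = 0 the truncated index makes \<open>Q (n - 1)\<close> equal to
    \<open>Q 0\<close>, but its coefficient (1 - q^0)^2 is 0.\<close>
  have Q: "[:0, 2:] * Q n = Q (Suc n) + smult (q ^ n * (a + b)) (Q n) + smult ((1 - q ^ n)\<^sup>2) (Q (n - 1))" for n
  proof (cases n)
    case 0
    then show ?thesis
      using aw_b[of 0] by (simp add: Q_def)
  next
    case (Suc m)
    show ?thesis
      using scaled_recurrence[of "2 ^ m" "aw_poly a b 0 0 q (Suc m)" "aw_b a b 0 0 q (Suc m)"
        "aw_lambda a b 0 0 q (Suc m)" "aw_poly a b 0 0 q m"]
      unfolding aw_b aw_lambda
      by (simp only: Suc Q_def diff_Suc_1 power_Suc aw_poly.simps(3))
  qed
  \<comment> \<open>The clause for k = 0 stands for U_(-1) = 0. For n > k + 1 all terms vanish;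
    otherwise m = k + 1 - n is the degree of the homogeneous sum.\<close>
  have G: "G n (Suc k) = G (Suc n) k + q ^ n * (a + b) * G n k + (1 - q ^ n)\<^sup>2 * G (n - 1) k
      - (if k = 0 then 0 else G n (k - 1))" for n k
  proof (cases "n \<le> Suc k")
    case True
    then obtain m where m: "Suc k = n + m"
      by (metis le_iff_add)
    have 1: "G n (Suc k) = S n m" "G n k = (if m = 0 then 0 else S n (m - 1))"
      "G (Suc n) k = (if m < 2 then 0 else S (Suc n) (m - 2))"
      "(if k = 0 then 0 else G n (k - 1)) = (if m < 2 then 0 else S n (m - 2))"
      using m by (auto simp: G_def intro!: arg_cong[of _ _ "S _"])
    have 2: "(1 - q ^ n)\<^sup>2 * G (n - 1) k = (1 - q ^ n)\<^sup>2 * S (n - 1) m"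
      using m by (cases n) (auto simp: G_def)
    have "n \<noteq> 0 \<or> m \<noteq> 0"
      using m by auto
    then show ?thesis
      unfolding eq_diff_eq 1 2 unfolding S_def by (rule hsum_aw_coeff_rec[OF q nz(2)])
  qed (auto simp: G_def)
  \<comment> \<open>The factor 2x is moved from U_k to P_n, which changes n by at most one; hence
    the induction on k keeps n arbitrary.\<close>
  have step: "L ([:0, 2:] * chebyshev_U k * Q n) =
      L (chebyshev_U k * Q (Suc n)) + q ^ n * (a + b) * L (chebyshev_U k * Q n)
      + (1 - q ^ n)\<^sup>2 * L (chebyshev_U k * Q (n - 1))" for k n
  proof -
    have "[:0, 2:] * chebyshev_U k * Q n = chebyshev_U k * ([:0, 2:] * Q n)"
      by (simp only: mult_ac)
    also have "\<dots> = chebyshev_U k * Q (Suc n) + smult (q ^ n * (a + b)) (chebyshev_U k * Q n)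
        + smult ((1 - q ^ n)\<^sup>2) (chebyshev_U k * Q (n - 1))"
      unfolding Q by (simp only: distrib_left mult_smult_right)
    finally show ?thesis
      by (simp only: L.add L.scale)
  qed
  have base: "L (chebyshev_U 0 * Q n) = G n 0" for n
    using LP[of n] L1
    by (cases n) (simp_all add: Q_def G_def S_def L.scale hsum_def aw_coeff_def qprod_0 flip: one_pCons)
  have "L (chebyshev_U k * Q n) = G n k" for n
  proof (induction k arbitrary: n rule: chebyshev_U.induct)
    case 1
    show ?case
      by (rule base)
  next
    case 2
    have "L (chebyshev_U (Suc 0) * Q n) = L ([:0, 2:] * chebyshev_U 0 * Q n)"
      by (simp only: chebyshev_U.simps mult_1_right)
    then show ?case
      unfolding step base by (subst G) simp
  next
    case (3 k)
    have "L (chebyshev_U (Suc (Suc k)) * Q n) =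
        L ([:0, 2:] * chebyshev_U (Suc k) * Q n) - L (chebyshev_U k * Q n)"
      by (simp only: chebyshev_U.simps left_diff_distrib L.diff)
    also have "\<dots> = G n (Suc (Suc k))"
      unfolding step 3 by (subst G) simp
    finally show ?case .
  qed
  from this[of n] show ?thesis
    by (simp add: Q_def G_def S_def b_def L.scale)
qed

section \<open>From Chebyshev values to moments\<close>

theorem corollary2p5:
  fixes a q :: "'a::field_char_0" and n :: nat
  assumes "a \<noteq> 0" and "q \<noteq> 0"
  shows "2^n * aw_moment a (q/a) 0 0 q n =
    (\<Sum>k=0..n.
      (of_nat (binom_ext n ((of_nat n - of_nat k) / 2))
        - of_nat (binom_ext n ((of_nat n - of_nat k) / 2 - 1)))
      * (q/a)^k
      * (\<Sum>i=0..k. a^(2*i) * q powi (int i * (int k - int i - 1))))"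
proof -
  define L where "L = aw_functional a (q/a) 0 0 q"
  have "is_aw_functional a (q/a) 0 0 q L"
    unfolding L_def by (rule is_aw_functional_aw_functional)
  then interpret L: Vector_Spaces.linear smult "(*)" L
    by (simp add: is_aw_functional_def)
  \<comment> \<open>Replacing (q/a)^(k-i) by (q/a)^k (a/q)^i yields the second a^i and lowers the
    exponent of q by i. At i = k > 0 that exponent is negative, hence the integer power.\<close>
  have summand: "a ^ i * (q/a) ^ (k - i) * q ^ (i * (k - i))
      = (q/a) ^ k * (a^(2*i) * q powi (int i * (int k - int i - 1)))" if "i \<le> k" for i k
  proof -
    obtain j where j: "k = i + j"
      using le_Suc_ex[OF \<open>i \<le> k\<close>] by blast
    have "int i * (int k - int i - 1) = int (i * j) - int i"
      by (simp add: j algebra_simps)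
    then have "q powi (int i * (int k - int i - 1)) = q ^ (i * j) / q ^ i"
      using power_int_diff[of q "int (i * j)" "int i"] assms by (simp only: power_int_of_nat simp_thms)
    then have "(q/a) ^ k * (a^(2*i) * q powi (int i * (int k - int i - 1)))
        = ((q/a) ^ i * a ^ i / q ^ i) * (a ^ i * (q/a) ^ j * q ^ (i * j))"
      unfolding mult_2 by (simp only: j power_add times_divide_eq_left times_divide_eq_right mult_ac)
    also have "(q/a) ^ i * a ^ i / q ^ i = 1"
      using assms by (simp flip: power_mult_distrib)
    finally show ?thesis
      by (simp add: j)
  qed
  have LU: "L (chebyshev_U k) = (q/a) ^ k * (\<Sum>i=0..k. a^(2*i) * q powi (int i * (int k - int i - 1)))" for k
  proof -
    \<comment> \<open>The case n = 0 of the product formula: P_0 = 1 and the q-products are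
      empty.\<close>
    have "L (chebyshev_U k) = (\<Sum>i\<le>k. a ^ i * (q/a) ^ (k - i) * q ^ (i * (k - i)))"
      using aw_functional_chebyshev_U_mult[OF assms, of 0 k]
      by (simp add: L_def hsum_def aw_coeff_def qprod_0)
    also have "\<dots> = (\<Sum>i=0..k. (q/a) ^ k * (a^(2*i) * q powi (int i * (int k - int i - 1))))"
      unfolding atMost_atLeast0 by (rule sum.cong) (simp_all only: summand atLeastAtMost_iff)
    finally show ?thesis
      by (simp only: sum_distrib_left)
  qed
  have "2^n * aw_moment a (q/a) 0 0 q n = L (monom (2 ^ n) n)"
    using L.scale[of "2 ^ n" "monom 1 n"] by (simp add: aw_moment_def L_def smult_monom)
  also have "\<dots> = (\<Sum>k=0..n. ballot n k * L (chebyshev_U k))"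
    by (simp add: monom_eq_sum_chebyshev_U L.sum L.scale atMost_atLeast0)
  finally show ?thesis
    unfolding LU ballot_def by (simp only: mult.assoc)
qed

end
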